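(* Let $d\ge 1$ and let $\{\mathbf{Y}_n\}_{n\ge 0}$ be an $\mathcal{S}_d^{+}$-valued supermartingale with respect to a filtration $\{\mathcal{F}_n\}_{n\ge 0}$. Then $\mathbf{Y}_n$ converges almost surely, as $n\to\infty$, to an $\mathcal{S}_d^{+}$-valued random matrix $\mathbf{Y}_\infty$, and $\mathbb{E}\,\mathbf{Y}_\infty \preceq \mathbb{E}\,\mathbf{Y}_0$.
   Context: $\mathcal{S}_d$ is the set of real symmetric $d\times d$ matrices and $\mathcal{S}_d^{+}$ the subset of positive semidefinite ones. $\preceq$ is the Loewner order: $\mathbf{A}\preceq\mathbf{B}$ iff $\mathbf{B}-\mathbf{A}$ is positive semidefinite. Expectations and conditional expectations of random matrices are entrywise. An $\mathcal{S}_d$-valued (integrable) process $\{\mathbf{Y}_n\}_{n\ge 0}$ adapted to a filtration $\{\mathcal{F}_n\}_{n\ge 0}$ is a supermartingale if $\mathbb{E}(\mathbf{Y}_n\mid\mathcal{F}_{n-1})\preceq\mathbf{Y}_{n-1}$ almost surely for all $n\ge 1$. *)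

theory Defs
  imports "HOL-Probability.Probability"
begin

definition sym_matrices :: "(real ^ 'd ^ 'd) set" where
  "sym_matrices = {A. transpose A = A}"

definition psd_matrices :: "(real ^ 'd ^ 'd) set" where
  "psd_matrices = {A \<in> sym_matrices. \<forall>x. 0 \<le> x \<bullet> (A *v x)}"

definition loewner_le :: "real ^ 'd ^ 'd \<Rightarrow> real ^ 'd ^ 'd \<Rightarrow> bool"  (infix "\<preceq>\<^sub>L" 50) where
  "A \<preceq>\<^sub>L B \<longleftrightarrow> B - A \<in> psd_matrices"

definition mat_expectation :: "'a measure \<Rightarrow> ('a \<Rightarrow> real ^ 'd ^ 'd) \<Rightarrow> real ^ 'd ^ 'd" where
  "mat_expectation M X = (\<chi> i j. \<integral>\<omega>. X \<omega> $ i $ j \<partial>M)"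

definition mat_cond_exp ::
  "'a measure \<Rightarrow> 'a measure \<Rightarrow> ('a \<Rightarrow> real ^ 'd ^ 'd) \<Rightarrow> 'a \<Rightarrow> real ^ 'd ^ 'd" where
  "mat_cond_exp M G X \<omega> = (\<chi> i j. real_cond_exp M G (\<lambda>\<omega>'. X \<omega>' $ i $ j) \<omega>)"

text \<open>
  The library predicate \<^const>\<open>filtration\<close> only fixes the common carrier and monotonicity;
  that each \<open>F n\<close> is a sub-sigma-algebra of \<open>M\<close> is a separate condition. The measure
  components of the \<open>F n\<close> are irrelevant.
\<close>

definition mat_supermartingale ::
  "'a measure \<Rightarrow> (nat \<Rightarrow> 'a measure) \<Rightarrow> (nat \<Rightarrow> 'a \<Rightarrow> real ^ 'd ^ 'd) \<Rightarrow> bool" where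
  "mat_supermartingale M F Y \<longleftrightarrow>
     filtration (space M) F \<and> (\<forall>n. subalgebra M (F n)) \<and>
     (\<forall>n. \<forall>\<omega>\<in>space M. Y n \<omega> \<in> sym_matrices) \<and>
     (\<forall>n. Y n \<in> borel_measurable (F n)) \<and>
     (\<forall>n. integrable M (Y n)) \<and>
     (\<forall>n\<ge>1. AE \<omega> in M. mat_cond_exp M (F (n - 1)) (Y n) \<omega> \<preceq>\<^sub>L Y (n - 1) \<omega>)"

text \<open>For integrable random matrices the entrywise expectation is the Bochner integral.\<close>

lemma mat_expectation_eq_integral:
  fixes X :: "'a \<Rightarrow> real ^ 'd ^ 'd"
  assumes "integrable M X"
  shows "mat_expectation M X = integral\<^sup>L M X"
proof -
  have "(\<integral>\<omega>. X \<omega> $ i $ j \<partial>M) = integral\<^sup>L M X $ i $ j" for i j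
    using integral_bounded_linear[OF bounded_linear_compose[OF bounded_linear_vec_nth
        bounded_linear_vec_nth] assms, of i j] by simp
  then show ?thesis
    by (simp add: mat_expectation_def vec_eq_iff)
qed

end

theory Submission
  imports Defs
begin

text \<open>
  For each vector \<open>x\<close> the quadratic form \<open>x \<bullet> (Y n *v x)\<close> is a nonnegative scalar
  supermartingale. Such a process converges almost surely by Doob's upcrossing argument: buying one
  unit below \<open>a\<close> and selling it above \<open>b\<close> gains at least \<open>b - a\<close> per upcrossing and loses at most
  \<open>\<bar>a\<bar>\<close> in the end, while the expected gain is nonpositive. Polarization at the vectors
  \<open>e\<^sub>i + e\<^sub>j\<close> turns convergence of the quadratic forms into convergence of the entries, and Fatou's
  lemma applied to the quadratic forms gives the comparison of expectations.
\<close>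

section \<open>Upcrossings of a real sequence\<close>

text \<open>\<open>holding a b x n\<close> means that the unit is held from time \<open>n\<close> to time \<open>n + 1\<close>.\<close>

primrec holding :: "real \<Rightarrow> real \<Rightarrow> (nat \<Rightarrow> real) \<Rightarrow> nat \<Rightarrow> bool" where
  "holding a b x 0 \<longleftrightarrow> x 0 < a"
| "holding a b x (Suc n) \<longleftrightarrow> (if holding a b x n then x (Suc n) \<le> b else x (Suc n) < a)"

text \<open>The counter moves at the sale, so a purchase not yet followed by a value above
  \<open>b\<close> contributes nothing.\<close>

primrec upcrossings :: "real \<Rightarrow> real \<Rightarrow> (nat \<Rightarrow> real) \<Rightarrow> nat \<Rightarrow> nat" where
  "upcrossings a b x 0 = 0"
| "upcrossings a b x (Suc n) =
     upcrossings a b x n + (if holding a b x n \<and> b < x (Suc n) then 1 else 0)"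

text \<open>This is the martingale transform of \<open>x\<close> by the indicator of
  \<open>holding\<close>: the position over the step from \<open>n\<close> to \<open>n + 1\<close>
  is fixed by the values up to time \<open>n\<close>.\<close>

primrec trading_gain :: "real \<Rightarrow> real \<Rightarrow> (nat \<Rightarrow> real) \<Rightarrow> nat \<Rightarrow> real" where
  "trading_gain a b x 0 = 0"
| "trading_gain a b x (Suc n) =
     trading_gain a b x n + (if holding a b x n then x (Suc n) - x n else 0)"

text \<open>The term \<open>x n - a\<close> values an open position as if it had been bought at
  \<open>a\<close>; the true price was lower, which only increases the gain. While the unit is held
  both sides grow equally, and a sale above \<open>b\<close> replaces this term by at least
  \<open>b - a\<close>. Carrying the open position along is what makes the induction close.\<close>

lemma trading_gain_ge:
  "(b - a) * upcrossings a b x n + (if holding a b x n then x n - a else 0) \<le> trading_gain a b x n"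
proof (induction n)
  case (Suc n)
  show ?case
  proof (cases "holding a b x n")
    case True
    with Suc have "(b - a) * upcrossings a b x n + (x n - a) \<le> trading_gain a b x n"
      by simp
    with True show ?thesis
      by (cases "b < x (Suc n)") (simp_all add: distrib_left)
  next
    case False
    with Suc have "(b - a) * upcrossings a b x n \<le> trading_gain a b x n"
      by simp
    with False show ?thesis
      by (cases "x (Suc n) < a") simp_all
  qed
qed simp

text \<open>Nonnegativity of \<open>x n\<close> limits the loss on an open position to
  \<open>a\<close>; the absolute value covers every sign of \<open>a\<close>.\<close>

lemma upcrossings_le_trading_gain:
  assumes "0 \<le> x n"
  shows "(b - a) * upcrossings a b x n \<le> trading_gain a b x n + \<bar>a\<bar>"
proof -
  have "- \<bar>a\<bar> \<le> (if holding a b x n then x n - a else 0)"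
    using assms abs_ge_self[of a] by (cases "holding a b x n") simp_all
  with trading_gain_ge[of b a x n] show ?thesis
    by linarith
qed

lemma incseq_upcrossings: "incseq (upcrossings a b x)"
  by (rule incseq_SucI) simp

text \<open>A bounded counter attains its maximum at some time \<open>N\<close>, and no sale happens
  afterwards. A later dip below \<open>a\<close> leaves the unit held, and it is then held forever,
  which keeps the sequence at or below \<open>b\<close> and contradicts
  \<open>above\<close>.\<close>

lemma upcrossings_unbounded:
  assumes below: "\<exists>\<^sub>F n in sequentially. x n < a" and above: "\<exists>\<^sub>F n in sequentially. b < x n"
  shows "\<exists>n. K \<le> upcrossings a b x n"
proof (rule ccontr)
  assume "\<not> ?thesis"
  then have "finite (range (upcrossings a b x))"
    by (auto intro: finite_subset[of _ "{..<K}"] simp: not_le)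
  then have max: "Max (range (upcrossings a b x)) \<in> range (upcrossings a b x)"
    and ge: "upcrossings a b x n \<le> Max (range (upcrossings a b x))" for n
    by (intro Max_in Max_ge; simp)+
  from max obtain N where "Max (range (upcrossings a b x)) = upcrossings a b x N" ..
  with ge have N: "upcrossings a b x n \<le> upcrossings a b x N" for n
    by simp
  have no_sale: "x (Suc n) \<le> b" if "N \<le> n" "holding a b x n" for n
    using N[of "Suc n"] incseqD[OF incseq_upcrossings, OF that(1), of a b x] that(2)
    by (auto split: if_splits simp: not_less)
  obtain n where n: "N < n" "x n < a"
    using below unfolding frequently_sequentially by (meson Suc_le_eq)
  \<comment> \<open>The status at \<open>n\<close> is decided by the status at \<open>p\<close>: a
    unit held at \<open>p\<close> is not sold because \<open>N \<le> p\<close>, and otherwise the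
    dip at \<open>n\<close> triggers a purchase.\<close>
  obtain p where p: "n = Suc p" "N \<le> p" using n(1) by (cases n) auto
  have held_n: "holding a b x n"
    using n no_sale[of p] p by auto
  have held: "holding a b x m" if "n \<le> m" for m
    using that by (induction m rule: dec_induct) (use n held_n no_sale in auto)
  obtain m where "n < m" "b < x m"
    using above unfolding frequently_sequentially by (meson Suc_le_eq)
  then show False
    using held[of "m - 1"] no_sale[of "m - 1"] n(1) by (cases m) auto
qed

section \<open>Nonnegative scalar supermartingales\<close>

text \<open>The supermartingale inequality is stated through integrals over events of
  \<open>F n\<close>. This is the form in which the trading strategy uses it, and the form that
  follows from entrywise conditional expectations by linearity of the integral.\<close>

locale nonneg_supermartingale = finite_measure M
  for M :: "'a measure" and F :: "nat \<Rightarrow> 'a measure" and X :: "nat \<Rightarrow> 'a \<Rightarrow> real" +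
  assumes filtration: "filtration (space M) F"
    and subalgebra: "\<And>n. subalgebra M (F n)"
    and adapted: "\<And>n. X n \<in> borel_measurable (F n)"
    and integrable: "\<And>n. integrable M (X n)"
    and nonneg: "\<And>n \<omega>. \<omega> \<in> space M \<Longrightarrow> 0 \<le> X n \<omega>"
    and set_integral_Suc_le: "\<And>n A. A \<in> sets (F n) \<Longrightarrow>
      (\<integral>\<omega>. indicator A \<omega> * X (Suc n) \<omega> \<partial>M) \<le> (\<integral>\<omega>. indicator A \<omega> * X n \<omega> \<partial>M)"
begin

lemma space_F [simp]: "space (F n) = space M"
  using subalgebra[of n] by (simp add: subalgebra_def)

lemma sets_F_mono: "m \<le> n \<Longrightarrow> sets (F m) \<subseteq> sets (F n)"
  using filtration by (simp add: filtration_def)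

lemma sets_F_subset: "A \<in> sets (F n) \<Longrightarrow> A \<in> sets M"
  using subalgebra[of n] by (auto simp: subalgebra_def)

lemma integral_le_initial: "(\<integral>\<omega>. X n \<omega> \<partial>M) \<le> (\<integral>\<omega>. X 0 \<omega> \<partial>M)"
proof (induction n)
  case (Suc n)
  have "(\<integral>\<omega>. indicator (space M) \<omega> * X k \<omega> \<partial>M) = (\<integral>\<omega>. X k \<omega> \<partial>M)" for k
    by (rule Bochner_Integration.integral_cong) auto
  moreover have "space M \<in> sets (F n)"
    using sets.top[of "F n"] by simp
  ultimately show ?case
    using Suc set_integral_Suc_le[of "space M" n] by simp
qed simp

section \<open>Doob's upcrossing inequality\<close>

lemma sets_holding: "{\<omega> \<in> space M. holding a b (\<lambda>n. X n \<omega>) n} \<in> sets (F n)"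
proof (induction n)
  case 0
  have [measurable]: "X 0 \<in> borel_measurable (F 0)" by (rule adapted)
  have "{\<omega> \<in> space (F 0). X 0 \<omega> < a} \<in> sets (F 0)" by measurable
  then show ?case by simp
next
  case (Suc n)
  have [measurable]: "X (Suc n) \<in> borel_measurable (F (Suc n))" by (rule adapted)
  let ?H = "{\<omega> \<in> space M. holding a b (\<lambda>n. X n \<omega>) n}"
  have H: "?H \<in> sets (F (Suc n))"
    using Suc sets_F_mono[of n "Suc n"] by auto
  have "{\<omega> \<in> space (F (Suc n)). X (Suc n) \<omega> \<le> b} \<in> sets (F (Suc n))"
    "{\<omega> \<in> space (F (Suc n)). X (Suc n) \<omega> < a} \<in> sets (F (Suc n))"
    by measurable
  \<comment> \<open>The status at \<open>Suc n\<close> is a Boolean combination of the status at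
    \<open>n\<close>, known by monotonicity of the filtration, and two threshold events of
    \<open>X (Suc n)\<close>. Membership in \<open>F n\<close>, and not just in \<open>M\<close>, is
    what makes the strategy admissible.\<close>
  then have "?H \<inter> {\<omega> \<in> space M. X (Suc n) \<omega> \<le> b} \<union> ({\<omega> \<in> space M. X (Suc n) \<omega> < a} - ?H)
      \<in> sets (F (Suc n))"
    using H by auto
  also have "?H \<inter> {\<omega> \<in> space M. X (Suc n) \<omega> \<le> b} \<union> ({\<omega> \<in> space M. X (Suc n) \<omega> < a} - ?H) =
      {\<omega> \<in> space M. holding a b (\<lambda>n. X n \<omega>) (Suc n)}"
    by auto
  finally show ?case .
qed

lemma pred_holding [measurable]: "Measurable.pred M (\<lambda>\<omega>. holding a b (\<lambda>n. X n \<omega>) n)"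
  using sets_holding sets_F_subset by (fastforce simp: pred_def)

lemma borel_measurable_X [measurable]: "X n \<in> borel_measurable M"
  using integrable by (rule borel_measurable_integrable)

lemma measurable_upcrossings [measurable]:
  "(\<lambda>\<omega>. upcrossings a b (\<lambda>n. X n \<omega>) n) \<in> measurable M (count_space UNIV)"
  by (induction n) simp_all

text \<open>Each increment is \<open>X (Suc n) - X n\<close> restricted to an event of
  \<open>F n\<close>, so its integral is nonpositive by the supermartingale inequality on that
  event.\<close>

lemma trading_gain_integral:
  "integrable M (\<lambda>\<omega>. trading_gain a b (\<lambda>n. X n \<omega>) n) \<and>
   (\<integral>\<omega>. trading_gain a b (\<lambda>n. X n \<omega>) n \<partial>M) \<le> 0"
proof (induction n)
  case (Suc n)
  define A where "A = {\<omega> \<in> space M. holding a b (\<lambda>n. X n \<omega>) n}"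
  have A: "A \<in> sets (F n)" "A \<in> sets M"
    unfolding A_def using sets_holding sets_F_subset by blast+
  have int: "integrable M (\<lambda>\<omega>. indicator A \<omega> * X k \<omega>)" for k
    using integrable_mult_indicator[OF A(2) integrable[of k]] by simp
  have eq: "trading_gain a b (\<lambda>n. X n \<omega>) (Suc n) = trading_gain a b (\<lambda>n. X n \<omega>) n +
      (indicator A \<omega> * X (Suc n) \<omega> - indicator A \<omega> * X n \<omega>)" if "\<omega> \<in> space M" for \<omega>
    using that by (auto simp: A_def)
  have "integrable M (\<lambda>\<omega>. trading_gain a b (\<lambda>n. X n \<omega>) (Suc n))"
    by (subst Bochner_Integration.integrable_cong[OF refl eq]) (use Suc int in auto)
  moreover have "(\<integral>\<omega>. trading_gain a b (\<lambda>n. X n \<omega>) (Suc n) \<partial>M) \<le> 0"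
    by (subst Bochner_Integration.integral_cong[OF refl eq])
      (use Suc int set_integral_Suc_le[OF A(1)] in auto)
  ultimately show ?case by blast
qed simp

text \<open>Integrate the pathwise bound and discard the nonpositive expected gain. The resulting
  bound does not depend on \<open>n\<close>.\<close>

lemma upcrossings_nn_integral_le:
  assumes "a < b"
  shows "(\<integral>\<^sup>+\<omega>. ennreal (upcrossings a b (\<lambda>n. X n \<omega>) n) \<partial>M)
    \<le> ennreal (\<bar>a\<bar> * measure M (space M) / (b - a))"
proof -
  let ?U = "\<lambda>\<omega>. real (upcrossings a b (\<lambda>n. X n \<omega>) n)"
  let ?G = "\<lambda>\<omega>. (trading_gain a b (\<lambda>n. X n \<omega>) n + \<bar>a\<bar>) / (b - a)"
  have le: "?U \<omega> \<le> ?G \<omega>" if "\<omega> \<in> space M" for \<omega>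
    using upcrossings_le_trading_gain[of "\<lambda>n. X n \<omega>" n b a] nonneg[OF that] assms
    by (simp add: pos_le_divide_eq mult.commute)
  have int: "integrable M ?G"
    using trading_gain_integral by auto
  have "(\<integral>\<^sup>+\<omega>. ennreal (?U \<omega>) \<partial>M) \<le> (\<integral>\<^sup>+\<omega>. ennreal (?G \<omega>) \<partial>M)"
    by (intro nn_integral_mono ennreal_leI le)
  \<comment> \<open>The integrand is nonnegative because it dominates the number of
    upcrossings.\<close>
  also have "\<dots> = ennreal (\<integral>\<omega>. ?G \<omega> \<partial>M)"
    by (rule nn_integral_eq_integral[OF int]) (use le order_trans[OF of_nat_0_le_iff] in blast)
  also have "(\<integral>\<omega>. ?G \<omega> \<partial>M) \<le> \<bar>a\<bar> * measure M (space M) / (b - a)"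
    using trading_gain_integral[of a b n] assms by (simp add: divide_right_mono mult.commute)
  finally show ?thesis
    by (simp add: ennreal_leI)
qed

text \<open>By monotone convergence the total number of upcrossings has finite expectation, so it is
  almost surely finite, whereas oscillation across the interval would force infinitely many.\<close>

lemma AE_no_oscillation:
  assumes "a < b"
  shows "AE \<omega> in M. \<not> ((\<exists>\<^sub>F n in sequentially. X n \<omega> < a) \<and> (\<exists>\<^sub>F n in sequentially. b < X n \<omega>))"
proof -
  let ?U = "\<lambda>n \<omega>. ennreal (upcrossings a b (\<lambda>n. X n \<omega>) n)"
  have "(\<integral>\<^sup>+\<omega>. (SUP n. ?U n \<omega>) \<partial>M) = (SUP n. \<integral>\<^sup>+\<omega>. ?U n \<omega> \<partial>M)"
    by (rule nn_integral_monotone_convergence_SUP)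
      (auto intro!: incseq_SucI simp: le_fun_def)
  also have "\<dots> \<le> ennreal (\<bar>a\<bar> * measure M (space M) / (b - a))"
    by (intro SUP_least upcrossings_nn_integral_le assms)
  finally have "(\<integral>\<^sup>+\<omega>. (SUP n. ?U n \<omega>) \<partial>M) \<noteq> \<infinity>"
    by (auto simp: top_unique)
  then have "AE \<omega> in M. (SUP n. ?U n \<omega>) \<noteq> \<infinity>"
    by (intro nn_integral_PInf_AE) auto
  then show ?thesis
  proof eventually_elim
    case (elim \<omega>)
    then obtain K :: nat where "(SUP n. ?U n \<omega>) < of_nat K"
      by (metis ennreal_Ex_less_of_nat infinity_ennreal_def less_top)
    then have "?U n \<omega> < of_nat K" for n
      by (meson SUP_lessD UNIV_I)
    then have "upcrossings a b (\<lambda>n. X n \<omega>) n < K" for n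
      by (simp add: ennreal_of_nat_eq_real_of_nat ennreal_less_iff)
    then show ?case
      using upcrossings_unbounded[of "\<lambda>n. X n \<omega>" a b K] by (meson not_le)
  qed
qed

text \<open>Fatou's lemma combined with the decrease of expectations. Working in
  \<open>ennreal\<close> gives the bound before any limit is known to exist.\<close>

lemma nn_integral_liminf_le:
  "(\<integral>\<^sup>+\<omega>. liminf (\<lambda>n. ennreal (X n \<omega>)) \<partial>M) \<le> ennreal (\<integral>\<omega>. X 0 \<omega> \<partial>M)"
proof -
  have "(\<integral>\<^sup>+\<omega>. liminf (\<lambda>n. ennreal (X n \<omega>)) \<partial>M) \<le> liminf (\<lambda>n. \<integral>\<^sup>+\<omega>. ennreal (X n \<omega>) \<partial>M)"
    by (rule nn_integral_liminf) measurable
  also have "\<dots> = liminf (\<lambda>n. ennreal (\<integral>\<omega>. X n \<omega> \<partial>M))"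
    by (simp add: nn_integral_eq_integral integrable nonneg)
  also have "\<dots> \<le> liminf (\<lambda>n. ennreal (\<integral>\<omega>. X 0 \<omega> \<partial>M))"
    by (intro Liminf_mono always_eventually allI ennreal_leI integral_le_initial)
  finally show ?thesis
    by (simp add: Liminf_const)
qed

theorem AE_convergent: "AE \<omega> in M. convergent (\<lambda>n. X n \<omega>)"
proof -
  have "AE \<omega> in M. liminf (\<lambda>n. ennreal (X n \<omega>)) \<noteq> \<infinity>"
    using nn_integral_liminf_le by (intro nn_integral_PInf_AE) (auto simp: top_unique)
  \<comment> \<open>Restricting to rational levels leaves countably many null sets to
    discard.\<close>
  moreover have "AE \<omega> in M. \<forall>r\<in>\<rat>. \<forall>s\<in>\<rat>. r < s \<longrightarrow>
      \<not> ((\<exists>\<^sub>F n in sequentially. X n \<omega> < r) \<and> (\<exists>\<^sub>F n in sequentially. s < X n \<omega>))"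
    by (intro AE_ball_countable' countable_rat AE_impI AE_no_oscillation)
  ultimately show ?thesis
    using AE_space
  proof eventually_elim
    case (elim \<omega>)
    let ?y = "\<lambda>n. ennreal (X n \<omega>)"
    have X: "0 \<le> X n \<omega>" for n using nonneg elim by blast
    have "liminf ?y = limsup ?y"
    proof (rule ccontr)
      assume "liminf ?y \<noteq> limsup ?y"
      then have lt: "liminf ?y < limsup ?y"
        by (simp add: Liminf_le_Limsup less_le)
      \<comment> \<open>If the lower and upper limits differ, two rational levels fit strictly
        between them, and the path crosses both infinitely often.\<close>
      obtain r :: rat where r: "liminf ?y < real_of_rat r" "real_of_rat r < limsup ?y"
        using ennreal_rat_dense[OF lt] by blast
      obtain s :: rat where s: "ennreal (real_of_rat r) < real_of_rat s" "real_of_rat s < limsup ?y"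
        using ennreal_rat_dense[OF r(2)] by blast
      \<comment> \<open>Monotonicity of \<open>ennreal\<close> suffices here, so the signs of the
        levels need no discussion.\<close>
      have less: "u < v" if "ennreal u < ennreal v" for u v
        using that by (metis ennreal_leI not_le)
      have "\<exists>\<^sub>F n in sequentially. ?y n < real_of_rat r"
        using r(1) Liminf_bounded[of "ennreal (real_of_rat r)" ?y sequentially]
        by (auto simp: frequently_def not_less)
      then have "\<exists>\<^sub>F n in sequentially. X n \<omega> < real_of_rat r"
        by (rule frequently_elim1) (rule less)
      moreover have "\<exists>\<^sub>F n in sequentially. ennreal (real_of_rat s) < ?y n"
        using s(2) Limsup_bounded[of ?y "ennreal (real_of_rat s)" sequentially]
        by (auto simp: frequently_def not_less)
      then have "\<exists>\<^sub>F n in sequentially. real_of_rat s < X n \<omega>"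
        by (rule frequently_elim1) (rule less)
      moreover have "real_of_rat r < real_of_rat s"
        using s(1) by (rule less)
      ultimately show False
        using elim(2) Rats_of_rat by blast
    qed
    \<comment> \<open>Finiteness of the lower limit rules out divergence to infinity and allows the
      return to the reals.\<close>
    then have "?y \<longlonglongrightarrow> ennreal (enn2real (liminf ?y))"
      using elim(1) by (intro Liminf_eq_Limsup) (simp_all add: less_top)
    then have "(\<lambda>n. X n \<omega>) \<longlonglongrightarrow> enn2real (liminf ?y)"
      using X by simp
    then show ?case
      by (rule convergentI)
  qed
qed

text \<open>Almost surely the limit agrees in \<open>ennreal\<close> with the lower limit, so the
  Fatou bound yields both integrability and the comparison of integrals.\<close>

lemma limit_integrable:
  assumes Z: "Z \<in> borel_measurable M" and lim: "AE \<omega> in M. (\<lambda>n. X n \<omega>) \<longlonglongrightarrow> Z \<omega>"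
  shows "integrable M Z" and "(\<integral>\<omega>. Z \<omega> \<partial>M) \<le> (\<integral>\<omega>. X 0 \<omega> \<partial>M)"
proof -
  have Z_nonneg: "AE \<omega> in M. 0 \<le> Z \<omega>"
    using lim AE_space by eventually_elim (auto intro!: LIMSEQ_le_const nonneg)
  have "(\<integral>\<^sup>+\<omega>. ennreal (Z \<omega>) \<partial>M) = (\<integral>\<^sup>+\<omega>. liminf (\<lambda>n. ennreal (X n \<omega>)) \<partial>M)"
  proof (rule nn_integral_cong_AE)
    show "AE \<omega> in M. ennreal (Z \<omega>) = liminf (\<lambda>n. ennreal (X n \<omega>))"
      using lim by eventually_elim (auto intro!: lim_imp_Liminf[symmetric])
  qed
  then have le: "(\<integral>\<^sup>+\<omega>. ennreal (Z \<omega>) \<partial>M) \<le> ennreal (\<integral>\<omega>. X 0 \<omega> \<partial>M)"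
    using nn_integral_liminf_le by simp
  then show int: "integrable M Z"
    using Z Z_nonneg by (intro integrableI_nonneg) (auto simp: less_top[symmetric] top_unique)
  \<comment> \<open>Since \<open>ennreal\<close> truncates negative numbers to 0, the bound passes
    back to the reals once its right side is known to be nonnegative.\<close>
  have "0 \<le> (\<integral>\<omega>. X 0 \<omega> \<partial>M)"
    by (simp add: nonneg)
  then show "(\<integral>\<omega>. Z \<omega> \<partial>M) \<le> (\<integral>\<omega>. X 0 \<omega> \<partial>M)"
    using le by (simp add: nn_integral_eq_integral[OF int Z_nonneg])
qed

end

section \<open>Quadratic forms\<close>

text \<open>For fixed \<open>x\<close> the form is linear in the matrix, hence bounded in finite
  dimension. Continuity, measurability and the exchange with the integral all come from
  this.\<close>

lemma bounded_linear_quadratic_form: "bounded_linear (\<lambda>A :: real ^ 'd ^ 'd. x \<bullet> (A *v x))"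
  by (intro linear_conv_bounded_linear[THEN iffD1] linearI)
    (simp_all add: matrix_vector_mult_add_rdistrib inner_add_right scaleR_matrix_vector_assoc[symmetric])

lemmas continuous_on_quadratic_form [continuous_intros] =
  bounded_linear.continuous_on[OF bounded_linear_quadratic_form]

lemmas borel_measurable_quadratic_form [measurable (raw)] =
  measurable_compose[OF _ borel_measurable_continuous_onI[OF linear_continuous_on[OF bounded_linear_quadratic_form]]]

lemma quadratic_form_eq_sum:
  fixes A :: "real ^ 'd ^ 'd"
  shows "x \<bullet> (A *v x) = (\<Sum>i\<in>UNIV. \<Sum>j\<in>UNIV. x $ i * x $ j * A $ i $ j)"
  by (simp add: inner_vec_def matrix_vector_mult_def sum_distrib_left mult_ac)

lemma sym_matrices_iff: "A \<in> sym_matrices \<longleftrightarrow> (\<forall>i j. A $ i $ j = A $ j $ i)"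
  by (auto simp: sym_matrices_def transpose_def vec_eq_iff)

text \<open>Polarization: expanding the form at the sum of two basis vectors produces the two mirror
  entries, which symmetry identifies.\<close>

lemma sym_matrix_entry_eq:
  assumes "A \<in> sym_matrices"
  shows "A $ i $ j = ((axis i 1 + axis j 1) \<bullet> (A *v (axis i 1 + axis j 1))
    - axis i 1 \<bullet> (A *v axis i 1) - axis j 1 \<bullet> (A *v axis j 1)) / 2"
proof -
  have entry: "axis k 1 \<bullet> (A *v axis l 1) = A $ k $ l" for k l
    by (simp add: matrix_vector_mult_basis inner_axis' column_def)
  have "A $ i $ j = A $ j $ i"
    using assms by (simp add: sym_matrices_iff)
  then show ?thesis
    by (simp add: matrix_vector_right_distrib inner_add_left inner_add_right entry)
qed

text \<open>The set is an intersection of closed conditions, one for each pair of indices and one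
  for each test vector. Closedness keeps pointwise limits positive semidefinite.\<close>

lemma closed_psd_matrices: "closed (psd_matrices :: (real ^ 'd ^ 'd) set)"
proof -
  have "psd_matrices = {A :: real ^ 'd ^ 'd. (\<forall>i j. A $ i $ j = A $ j $ i) \<and> (\<forall>x. 0 \<le> x \<bullet> (A *v x))}"
    by (auto simp: psd_matrices_def sym_matrices_iff)
  also have "closed \<dots>"
    by (intro closed_Collect_conj closed_Collect_all closed_Collect_eq closed_Collect_le continuous_intros)
  finally show ?thesis .
qed

lemma zero_in_psd_matrices: "0 \<in> psd_matrices"
  by (simp add: psd_matrices_def sym_matrices_iff)

lemma integrable_matrixI:
  fixes Z :: "'a \<Rightarrow> real ^ 'd ^ 'd"
  assumes Z: "Z \<in> borel_measurable M" and entries: "\<And>i j. integrable M (\<lambda>\<omega>. Z \<omega> $ i $ j)"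
  shows "integrable M Z"
proof (rule Bochner_Integration.integrable_bound)
  show "integrable M (\<lambda>\<omega>. \<Sum>i\<in>UNIV. \<Sum>j\<in>UNIV. \<bar>Z \<omega> $ i $ j\<bar>)"
    by (intro Bochner_Integration.integrable_sum integrable_abs entries)
  have "norm A \<le> (\<Sum>i\<in>UNIV. \<Sum>j\<in>UNIV. \<bar>A $ i $ j\<bar>)" for A :: "real ^ 'd ^ 'd"
  proof -
    have "norm A \<le> (\<Sum>i\<in>UNIV. norm (A $ i))"
      unfolding norm_vec_def by (rule L2_set_le_sum) simp
    also have "\<dots> \<le> (\<Sum>i\<in>UNIV. \<Sum>j\<in>UNIV. \<bar>A $ i $ j\<bar>)"
      by (intro sum_mono norm_le_l1_cart)
    finally show ?thesis .
  qed
  then show "AE \<omega> in M. norm (Z \<omega>) \<le> norm (\<Sum>i\<in>UNIV. \<Sum>j\<in>UNIV. \<bar>Z \<omega> $ i $ j\<bar>)"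
    by (auto simp: sum_nonneg)
qed (rule Z)

lemma quadratic_form_mat_expectation:
  assumes "integrable M Z"
  shows "x \<bullet> (mat_expectation M Z *v x) = (\<integral>\<omega>. x \<bullet> (Z \<omega> *v x) \<partial>M)"
  using integral_bounded_linear[OF bounded_linear_quadratic_form assms, of x]
  by (simp add: mat_expectation_eq_integral[OF assms])

lemma mat_expectation_sym:
  assumes "\<And>\<omega>. \<omega> \<in> space M \<Longrightarrow> Z \<omega> \<in> sym_matrices"
  shows "mat_expectation M Z \<in> sym_matrices"
  using assms by (auto simp: sym_matrices_iff mat_expectation_def intro!: Bochner_Integration.integral_cong)

section \<open>From matrix to scalar supermartingales\<close>

lemma nonneg_supermartingale_quadratic_form:
  fixes Y :: "nat \<Rightarrow> 'a \<Rightarrow> real ^ 'd ^ 'd"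
  assumes "finite_measure M" and super: "mat_supermartingale M F Y"
    and psd: "\<And>n \<omega>. \<omega> \<in> space M \<Longrightarrow> Y n \<omega> \<in> psd_matrices"
  shows "nonneg_supermartingale M F (\<lambda>n \<omega>. x \<bullet> (Y n \<omega> *v x))"
proof -
  interpret finite_measure M by fact
  have filt: "filtration (space M) F" and sub: "subalgebra M (F n)"
    and meas: "Y n \<in> borel_measurable (F n)" and int: "integrable M (Y n)" for n
    using super by (auto simp: mat_supermartingale_def)
  have cond: "AE \<omega> in M. mat_cond_exp M (F n) (Y (Suc n)) \<omega> \<preceq>\<^sub>L Y n \<omega>" for n
  proof -
    have "\<forall>n\<ge>1. AE \<omega> in M. mat_cond_exp M (F (n - 1)) (Y n) \<omega> \<preceq>\<^sub>L Y (n - 1) \<omega>"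
      using super by (simp add: mat_supermartingale_def)
    from this[rule_format, of "Suc n"] show ?thesis by simp
  qed
  have int_q: "integrable M (\<lambda>\<omega>. x \<bullet> (Y n \<omega> *v x))" for n
    by (rule integrable_bounded_linear[OF bounded_linear_quadratic_form int])
  show ?thesis
  proof (intro nonneg_supermartingale.intro nonneg_supermartingale_axioms.intro, goal_cases)
    case 1 show ?case by fact
  next
    case 2 show ?case by (rule filt)
  next
    case (3 n) show ?case by (rule sub)
  next
    case (4 n)
    have [measurable]: "Y n \<in> borel_measurable (F n)" by (rule meas)
    show ?case by measurable
  next
    case (5 n) show ?case by (rule int_q)
  next
    case (6 \<omega> n)
    then show ?case using psd by (auto simp: psd_matrices_def)
  next
    case (7 n A)
    interpret fsub: finite_measure_subalgebra M "F n"
      by unfold_locales (rule sub)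
    let ?C = "mat_cond_exp M (F n) (Y (Suc n))"
    have A: "A \<in> sets M" using 7 sub[of n] by (auto simp: subalgebra_def)
    have ent: "integrable M (\<lambda>\<omega>. Y k \<omega> $ i $ j)" for k i j
      by (intro integrable_bounded_linear[OF bounded_linear_compose[OF bounded_linear_vec_nth bounded_linear_vec_nth]] int)
    have C_int: "integrable M (\<lambda>\<omega>. ?C \<omega> $ i $ j)" for i j
      using fsub.real_cond_exp_int(1)[OF ent] by (simp add: mat_cond_exp_def)
    have C_eq: "(\<integral>\<omega>. indicator A \<omega> * Y (Suc n) \<omega> $ i $ j \<partial>M) = (\<integral>\<omega>. indicator A \<omega> * ?C \<omega> $ i $ j \<partial>M)" for i j
      using fsub.real_cond_exp_intA[OF ent 7] by (simp add: mat_cond_exp_def set_lebesgue_integral_def)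
    have intA: "integrable M (\<lambda>\<omega>. indicator A \<omega> * f \<omega>)" if "integrable M f" for f :: "'a \<Rightarrow> real"
      using integrable_mult_indicator[OF A that] by simp
    \<comment> \<open>Conditional expectation is defined entrywise, so the form is expanded into
      entries; each entry has the same integral over \<open>A\<close> as its conditional
      expectation.\<close>
    have expand: "(\<integral>\<omega>. indicator A \<omega> * (x \<bullet> (Z \<omega> *v x)) \<partial>M) =
        (\<Sum>i\<in>UNIV. \<Sum>j\<in>UNIV. x $ i * x $ j * (\<integral>\<omega>. indicator A \<omega> * Z \<omega> $ i $ j \<partial>M))"
      if "\<And>i j. integrable M (\<lambda>\<omega>. Z \<omega> $ i $ j)" for Z :: "'a \<Rightarrow> real ^ 'd ^ 'd"
    proof -
      have "(\<integral>\<omega>. indicator A \<omega> * (x \<bullet> (Z \<omega> *v x)) \<partial>M) =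
          (\<integral>\<omega>. (\<Sum>i\<in>UNIV. \<Sum>j\<in>UNIV. x $ i * x $ j * (indicator A \<omega> * Z \<omega> $ i $ j)) \<partial>M)"
        by (simp add: quadratic_form_eq_sum sum_distrib_left mult_ac)
      also have "\<dots> = (\<Sum>i\<in>UNIV. \<Sum>j\<in>UNIV. x $ i * x $ j * (\<integral>\<omega>. indicator A \<omega> * Z \<omega> $ i $ j \<partial>M))"
        by (simp add: Bochner_Integration.integral_sum intA that)
      finally show ?thesis .
    qed
    have "(\<integral>\<omega>. indicator A \<omega> * (x \<bullet> (Y (Suc n) \<omega> *v x)) \<partial>M) =
        (\<integral>\<omega>. indicator A \<omega> * (x \<bullet> (?C \<omega> *v x)) \<partial>M)"
      by (simp add: expand ent C_int C_eq)
    \<comment> \<open>Testing the Loewner inequality with \<open>x\<close> gives an almost sure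
      scalar inequality, which survives multiplication by the indicator and integration.\<close>
    also have "\<dots> \<le> (\<integral>\<omega>. indicator A \<omega> * (x \<bullet> (Y n \<omega> *v x)) \<partial>M)"
    proof (intro integral_mono_AE intA int_q)
      show "integrable M (\<lambda>\<omega>. x \<bullet> (?C \<omega> *v x))"
        unfolding quadratic_form_eq_sum
        by (intro Bochner_Integration.integrable_sum integrable_mult_right C_int)
      show "AE \<omega> in M. indicator A \<omega> * (x \<bullet> (?C \<omega> *v x)) \<le> indicator A \<omega> * (x \<bullet> (Y n \<omega> *v x))"
        using cond[of n]
        by eventually_elim
          (auto simp: loewner_le_def psd_matrices_def matrix_vector_mult_diff_rdistrib inner_diff_right
            intro!: mult_left_mono)
    qed
    finally show ?case .
  qed
qed

section \<open>Assembling the matrix limit from its quadratic forms\<close>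

theorem theorem3p2:
  fixes M :: "'a measure" and F :: "nat \<Rightarrow> 'a measure"
    and Y :: "nat \<Rightarrow> 'a \<Rightarrow> real ^ 'd ^ 'd"
  assumes "prob_space M"
    and "mat_supermartingale M F Y"
    and "\<And>n \<omega>. \<omega> \<in> space M \<Longrightarrow> Y n \<omega> \<in> psd_matrices"
  shows "\<exists>Yinf :: 'a \<Rightarrow> real ^ 'd ^ 'd.
           Yinf \<in> borel_measurable M \<and>
           (\<forall>\<omega>\<in>space M. Yinf \<omega> \<in> psd_matrices) \<and>
           (AE \<omega> in M. (\<lambda>n. Y n \<omega>) \<longlonglongrightarrow> Yinf \<omega>) \<and>
           integrable M Yinf \<and>
           mat_expectation M Yinf \<preceq>\<^sub>L mat_expectation M (Y 0)"
proof -
  interpret prob_space M by fact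
  have q: "nonneg_supermartingale M F (\<lambda>n \<omega>. x \<bullet> (Y n \<omega> *v x))" for x
    by (rule nonneg_supermartingale_quadratic_form[OF _ assms(2,3)]) unfold_locales
  have int_Y: "integrable M (Y n)" for n
    using assms(2) by (simp add: mat_supermartingale_def)
  have [measurable]: "Y n \<in> borel_measurable M" for n
    using int_Y by (rule borel_measurable_integrable)
  have Y_sym: "Y n \<omega> \<in> sym_matrices" if "\<omega> \<in> space M" for n \<omega>
    using assms(3)[OF that] by (simp add: psd_matrices_def)
  \<comment> \<open>The Cauchy criterion makes the case split measurable. The default value 0 is
    positive semidefinite, so \<open>Yinf\<close> has values in \<open>psd_matrices\<close> on all
    of \<open>space M\<close>.\<close>
  define Yinf where "Yinf \<omega> = (if Cauchy (\<lambda>n. Y n \<omega>) then lim (\<lambda>n. Y n \<omega>) else 0)" for \<omega>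
  have Yinf_meas [measurable]: "Yinf \<in> borel_measurable M"
    unfolding Yinf_def by measurable
  have limD: "(\<lambda>n. Y n \<omega>) \<longlonglongrightarrow> Yinf \<omega>" if "convergent (\<lambda>n. Y n \<omega>)" for \<omega>
    using that by (simp add: Yinf_def Cauchy_convergent_iff convergent_LIMSEQ_iff)
  have Yinf_psd: "Yinf \<omega> \<in> psd_matrices" if "\<omega> \<in> space M" for \<omega>
  proof (cases "Cauchy (\<lambda>n. Y n \<omega>)")
    case True
    show ?thesis
      by (rule closed_sequentially[OF closed_psd_matrices _ limD])
        (use True assms(3) that in \<open>auto simp: Cauchy_convergent_iff\<close>)
  qed (simp add: Yinf_def zero_in_psd_matrices)
  have Yinf_sym: "Yinf \<omega> \<in> sym_matrices" if "\<omega> \<in> space M" for \<omega>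
    using Yinf_psd[OF that] by (simp add: psd_matrices_def)
  \<comment> \<open>Polarization involves only finitely many vectors, so a single null set serves
    all entries.\<close>
  have "AE \<omega> in M. \<forall>i j :: 'd. \<forall>x\<in>{axis i 1 + axis j 1, axis i 1, axis j 1}.
      convergent (\<lambda>n. x \<bullet> (Y n \<omega> *v x))"
    by (simp add: AE_all_countable nonneg_supermartingale.AE_convergent[OF q])
  then have lim: "AE \<omega> in M. (\<lambda>n. Y n \<omega>) \<longlonglongrightarrow> Yinf \<omega>"
    using AE_space
  proof eventually_elim
    case (elim \<omega>)
    have "convergent (\<lambda>n. Y n \<omega> $ i $ j)" for i j
      unfolding sym_matrix_entry_eq[OF Y_sym[OF elim(2)], of _ i j]
      unfolding divide_inverse
      using elim(1) by (intro convergent_mult convergent_diff convergent_const) auto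
    then obtain L where "\<And>i j. (\<lambda>n. Y n \<omega> $ i $ j) \<longlonglongrightarrow> L i j"
      unfolding convergent_def by metis
    then have "(\<lambda>n. Y n \<omega>) \<longlonglongrightarrow> (\<chi> i j. L i j)"
      by (intro vec_tendstoI) simp
    then show ?case
      by (intro limD) (auto simp: convergent_def)
  qed
  have lim_q: "AE \<omega> in M. (\<lambda>n. x \<bullet> (Y n \<omega> *v x)) \<longlonglongrightarrow> x \<bullet> (Yinf \<omega> *v x)" for x
    using lim by eventually_elim (rule bounded_linear.tendsto[OF bounded_linear_quadratic_form])
  note Fatou = nonneg_supermartingale.limit_integrable[OF q _ lim_q]
  have int_q: "integrable M (\<lambda>\<omega>. x \<bullet> (Yinf \<omega> *v x))" for x
    by (rule Fatou) measurable
  have int: "integrable M Yinf"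
  proof (rule integrable_matrixI[OF Yinf_meas])
    fix i j
    show "integrable M (\<lambda>\<omega>. Yinf \<omega> $ i $ j)"
      \<comment> \<open>Symmetry at every point of \<open>space M\<close> allows each entry to be
        replaced by its polarization formula, whose three forms are integrable by Fatou.\<close>
      by (subst Bochner_Integration.integrable_cong[OF refl sym_matrix_entry_eq[OF Yinf_sym]])
        (assumption, intro integrable_divide_zero Bochner_Integration.integrable_diff int_q)
  qed
  have "mat_expectation M Yinf \<preceq>\<^sub>L mat_expectation M (Y 0)"
    unfolding loewner_le_def psd_matrices_def
  proof (intro CollectI conjI allI)
    show "mat_expectation M (Y 0) - mat_expectation M Yinf \<in> sym_matrices"
      using mat_expectation_sym[of M "Y 0", OF Y_sym] mat_expectation_sym[of M Yinf, OF Yinf_sym]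
      by (simp add: sym_matrices_iff)
    fix x
    have "(\<integral>\<omega>. x \<bullet> (Yinf \<omega> *v x) \<partial>M) \<le> (\<integral>\<omega>. x \<bullet> (Y 0 \<omega> *v x) \<partial>M)"
      by (rule Fatou) measurable
    then show "0 \<le> x \<bullet> ((mat_expectation M (Y 0) - mat_expectation M Yinf) *v x)"
      by (simp add: matrix_vector_mult_diff_rdistrib inner_diff_right quadratic_form_mat_expectation int int_Y)
  qed
  then show ?thesis
    using Yinf_meas Yinf_psd lim int by blast
qed

end
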